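(* Let $\Phi$ be a (possibly reducible) finite crystallographic root system, with Weyl group $W$, simple system $\Pi$, fundamental chamber $\mathcal C$ and root polytope $\mathcal P_\Phi$, and let $F$ be a face of $\mathcal P_\Phi$. (1) $F$ is standard if and only if the barycenter $\beta_F$ is dominant. In this case, the stabilizer $\mathrm{Stab}_W(F)$ of $F$ is the standard parabolic subgroup of $W$ generated by $\Pi\cap\beta_F^\perp$ (that is, by the reflections $s_\alpha$ with $\alpha\in\Pi\cap\beta_F^\perp$). (2) The orbit $W\cdot F$ of $F$ under the action of $W$ on the faces of $\mathcal P_\Phi$ contains exactly one standard face.
   Context: $\Phi$ is a finite reduced crystallographic root system in the real vector space $\mathbb E=\mathrm{Span}_{\mathbb R}\Phi$ with ($W$-invariant) positive definite bilinear form $(\cdot,\cdot)$; $\Pi$ is a set of simple roots, $W$ the Weyl group, $s_\alpha$ the reflection with respect to $\alpha$. $\mathcal C=\{x\in\mathbb E:(x,\alpha)\ge 0\ \forall \alpha\in\Pi\}$ is the (closed) fundamental chamber associated with $\Pi$; $x\in\mathbb E$ is dominant if $x\in\mathcal C$. The root polytope $\mathcal P_\Phi$ is the convex hull of all roots in $\Phi$. For a face $F$ of $\mathcal P_\Phi$ with vertex set $V$, $\beta_F=\frac1{|V|}\sum_{v\in V}v$ is the barycenter of $V$, and $\mathrm{Stab}_W(F)=\{w\in W: w(F)=F\}$. The relative interior of $F$ is its interior within the affine hull of $F$. A face $F$ is called standard if either its relative interior meets $\mathcal C$, or $F=\emptyset$. *)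

theory Defs
  imports "HOL-Analysis.Analysis"
begin

text \<open>
  The root system lives in the subspace \<open>span \<Phi>\<close> (written E in the literature) of an arbitrary
  Euclidean space, and the ambient inner product plays the role of the positive definite invariant
  form. The roots are not required to span the whole type, so that rank 0 is not excluded.
\<close>

definition reflection :: "'a::euclidean_space \<Rightarrow> 'a \<Rightarrow> 'a" where
  "reflection \<alpha> x = x - (2 * (x \<bullet> \<alpha>) / (\<alpha> \<bullet> \<alpha>)) *\<^sub>R \<alpha>"

definition root_system :: "'a::euclidean_space set \<Rightarrow> bool" where
  "root_system \<Phi> \<longleftrightarrow>
     finite \<Phi> \<and> 0 \<notin> \<Phi> \<and>
     (\<forall>\<alpha>\<in>\<Phi>. \<Phi> \<inter> span {\<alpha>} = {\<alpha>, - \<alpha>}) \<and>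
     (\<forall>\<alpha>\<in>\<Phi>. reflection \<alpha> ` \<Phi> = \<Phi>) \<and>
     (\<forall>\<alpha>\<in>\<Phi>. \<forall>\<beta>\<in>\<Phi>. 2 * (\<beta> \<bullet> \<alpha>) / (\<alpha> \<bullet> \<alpha>) \<in> \<int>)"

text \<open>
  The last condition forces \<open>\<Delta>\<close> to span \<open>span \<Phi>\<close>, so that \<open>\<Delta>\<close> is a basis of it.
\<close>

definition simple_system :: "'a::euclidean_space set \<Rightarrow> 'a set \<Rightarrow> bool" where
  "simple_system \<Phi> \<Delta> \<longleftrightarrow>
     \<Delta> \<subseteq> \<Phi> \<and> independent \<Delta> \<and>
     (\<forall>\<beta>\<in>\<Phi>. \<exists>c :: 'a \<Rightarrow> int.
        \<beta> = (\<Sum>\<alpha>\<in>\<Delta>. of_int (c \<alpha>) *\<^sub>R \<alpha>) \<and>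
        ((\<forall>\<alpha>\<in>\<Delta>. 0 \<le> c \<alpha>) \<or> (\<forall>\<alpha>\<in>\<Delta>. c \<alpha> \<le> 0)))"

text \<open>
  The group of linear maps generated by the reflections \<open>s\<^sub>\<alpha>\<close>, \<open>\<alpha> \<in> A\<close>. Closure under inverses
  need not be imposed because reflections are involutions; see \<open>refl_group_inverse\<close> below. The maps
  are defined on the whole type and fix the orthogonal complement of \<open>span A\<close> pointwise.
\<close>

inductive_set refl_group :: "'a::euclidean_space set \<Rightarrow> ('a \<Rightarrow> 'a) set"
  for A :: "'a set" where
  refl_group_id: "id \<in> refl_group A"
| refl_group_step: "\<alpha> \<in> A \<Longrightarrow> w \<in> refl_group A \<Longrightarrow> reflection \<alpha> \<circ> w \<in> refl_group A"

definition Weyl_group :: "'a::euclidean_space set \<Rightarrow> ('a \<Rightarrow> 'a) set" where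
  "Weyl_group \<Phi> = refl_group \<Phi>"

definition fundamental_chamber :: "'a::euclidean_space set \<Rightarrow> 'a set \<Rightarrow> 'a set" where
  "fundamental_chamber \<Phi> \<Delta> = {x \<in> span \<Phi>. \<forall>\<alpha>\<in>\<Delta>. 0 \<le> x \<bullet> \<alpha>}"

definition dominant :: "'a::euclidean_space set \<Rightarrow> 'a set \<Rightarrow> 'a \<Rightarrow> bool" where
  "dominant \<Phi> \<Delta> x \<longleftrightarrow> x \<in> fundamental_chamber \<Phi> \<Delta>"

definition root_polytope :: "'a::euclidean_space set \<Rightarrow> 'a set" where
  "root_polytope \<Phi> = convex hull \<Phi>"

definition vertices :: "'a::euclidean_space set \<Rightarrow> 'a set" where
  "vertices F = {v. v extreme_point_of F}"

text \<open>
  For the empty face this is 0, since division by zero yields zero and the empty sum is zero.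
\<close>

definition barycenter :: "'a::euclidean_space set \<Rightarrow> 'a" where
  "barycenter F = (1 / real (card (vertices F))) *\<^sub>R (\<Sum>v\<in>vertices F. v)"

definition standard_face :: "'a::euclidean_space set \<Rightarrow> 'a set \<Rightarrow> 'a set \<Rightarrow> bool" where
  "standard_face \<Phi> \<Delta> F \<longleftrightarrow> rel_interior F \<inter> fundamental_chamber \<Phi> \<Delta> \<noteq> {} \<or> F = {}"

definition face_stabilizer :: "('a \<Rightarrow> 'a) set \<Rightarrow> 'a set \<Rightarrow> ('a \<Rightarrow> 'a) set" where
  "face_stabilizer W F = {w \<in> W. w ` F = F}"

definition face_orbit :: "('a \<Rightarrow> 'a) set \<Rightarrow> 'a set \<Rightarrow> 'a set set" where
  "face_orbit W F = {w ` F | w. w \<in> W}"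

lemma reflection_involution: "reflection \<alpha> (reflection \<alpha> x) = x"
  by (cases "\<alpha> = 0") (simp_all add: reflection_def inner_diff_left algebra_simps)

lemma refl_group_comp: "v \<in> refl_group A \<Longrightarrow> w \<in> refl_group A \<Longrightarrow> v \<circ> w \<in> refl_group A"
  by (induction v rule: refl_group.induct) (auto simp: comp_assoc intro: refl_group.intros)

lemma refl_group_inverse:
  assumes "w \<in> refl_group A"
  shows "\<exists>v\<in>refl_group A. v \<circ> w = id \<and> w \<circ> v = id"
  using assms
proof (induction w rule: refl_group.induct)
  case refl_group_id
  show ?case using refl_group.refl_group_id[of A] by (intro bexI[of _ id]) auto
next
  case (refl_group_step \<alpha> w)
  then obtain v where v: "v \<in> refl_group A" "v \<circ> w = id" "w \<circ> v = id" by blast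
  have "reflection \<alpha> \<in> refl_group A"
    using refl_group.refl_group_step[OF refl_group_step.hyps(1) refl_group.refl_group_id] by simp
  with v(1) have "v \<circ> reflection \<alpha> \<in> refl_group A" by (rule refl_group_comp)
  moreover have "(v \<circ> reflection \<alpha>) \<circ> (reflection \<alpha> \<circ> w) = id"
    "(reflection \<alpha> \<circ> w) \<circ> (v \<circ> reflection \<alpha>) = id"
    using v(2,3) by (simp_all add: fun_eq_iff reflection_involution)
  ultimately show ?case by blast
qed

end

theory Submission
  imports Defs
begin

text \<open>
  If a reflection hyperplane meets the relative interior of a face \<open>F\<close>, then \<open>F\<close> and its mirror
  image are faces with intersecting relative interiors, hence equal. So for every root \<open>\<alpha>\<close> either
  the reflection in \<open>\<alpha>\<close> stabilizes \<open>F\<close>, and then \<open>\<alpha>\<close> is orthogonal to the barycenter, or \<open>\<alpha>\<close> has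
  constant sign on the relative interior of \<open>F\<close>, which contains the barycenter. This turns a
  standard face into a face with dominant barycenter, and the stabilizer and orbit of \<open>F\<close> into
  those of its barycenter. For points these are Chevalley's theorem on stabilizers and the fact
  that the chamber is a fundamental domain.
\<close>

section \<open>Reflections and the groups they generate\<close>

lemma linear_reflection: "linear (reflection \<alpha>)"
  by (rule linearI) (simp_all add: reflection_def inner_add_left add_divide_distrib algebra_simps)

lemma inner_reflection: "reflection \<alpha> x \<bullet> reflection \<alpha> y = x \<bullet> y"
  by (cases "\<alpha> = 0") (simp_all add: reflection_def inner_commute algebra_simps)

lemma inner_reflection_left: "reflection \<alpha> x \<bullet> y = x \<bullet> reflection \<alpha> y"
  by (metis inner_reflection reflection_involution)

lemma reflection_self: "reflection \<alpha> \<alpha> = - \<alpha>"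
  by (cases "\<alpha> = 0") (simp_all add: reflection_def algebra_simps scaleR_2)

lemma reflection_eq_self_iff: "reflection \<alpha> x = x \<longleftrightarrow> x \<bullet> \<alpha> = 0"
  by (cases "\<alpha> = 0") (auto simp: reflection_def)

lemma reflection_uminus_root: "reflection (- \<alpha>) = reflection \<alpha>"
  by (simp add: fun_eq_iff reflection_def)

lemma reflection_in_refl_group: "\<alpha> \<in> A \<Longrightarrow> reflection \<alpha> \<in> refl_group A"
  using refl_group_step[OF _ refl_group_id] by fastforce

lemma linear_refl_group: "w \<in> refl_group A \<Longrightarrow> linear w"
  by (induction rule: refl_group.induct)
    (blast intro: linear_compose linear_reflection linear_id)+

lemma inner_refl_group: "w \<in> refl_group A \<Longrightarrow> w x \<bullet> w y = x \<bullet> y"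
  by (induction rule: refl_group.induct) (auto simp: inner_reflection)

lemma bij_refl_group: "w \<in> refl_group A \<Longrightarrow> bij w"
  using refl_group_inverse o_bij by metis

lemma refl_group_mono: "A \<subseteq> B \<Longrightarrow> refl_group A \<subseteq> refl_group B"
proof
  fix w assume AB: "A \<subseteq> B" and "w \<in> refl_group A"
  from this(2) show "w \<in> refl_group B"
    by (induction rule: refl_group.induct) (use AB in \<open>blast intro: refl_group.intros\<close>)+
qed

lemma refl_group_fixes:
  assumes "w \<in> refl_group A" "\<And>\<alpha>. \<alpha> \<in> A \<Longrightarrow> x \<bullet> \<alpha> = 0"
  shows "w x = x"
  using assms by (induction rule: refl_group.induct) (auto simp: reflection_eq_self_iff)

text \<open>Holds because \<open>w\<close> is a linear isometry. It is the relation w s_\<alpha> =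
  s_(w \<alpha>) w, which moves a reflection past a group element.\<close>

lemma reflection_conjugate:
  assumes "w \<in> refl_group A"
  shows "reflection (w \<alpha>) (w x) = w (reflection \<alpha> x)"
  using linear_refl_group[OF assms]
  by (simp add: reflection_def inner_refl_group[OF assms] linear_diff linear_scale)

text \<open>Membership in \<open>refl_group\<close> carries no length, while the exchange argument
  inducts on word length; hence words are explicit lists of roots. The last letter acts
  first.\<close>

definition refl_prod :: "'a::euclidean_space list \<Rightarrow> 'a \<Rightarrow> 'a" where
  "refl_prod as = foldr (\<lambda>\<alpha> w. reflection \<alpha> \<circ> w) as id"

lemma refl_prod_simps [simp]:
  "refl_prod [] = id"
  "refl_prod (\<alpha> # as) = reflection \<alpha> \<circ> refl_prod as"
  by (simp_all add: refl_prod_def)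

lemma refl_prod_append: "refl_prod (as @ bs) = refl_prod as \<circ> refl_prod bs"
  by (induction as) (auto simp: comp_assoc)

lemma refl_prod_in_refl_group: "set as \<subseteq> A \<Longrightarrow> refl_prod as \<in> refl_group A"
  by (induction as) (auto intro: refl_group.intros)

lemma refl_group_refl_prodE:
  assumes "w \<in> refl_group A"
  obtains as where "set as \<subseteq> A" "w = refl_prod as"
proof -
  have "\<exists>as. set as \<subseteq> A \<and> w = refl_prod as"
    using assms
  proof (induction rule: refl_group.induct)
    case refl_group_id
    show ?case by (intro exI[of _ "[]"]) simp
  next
    case (refl_group_step \<alpha> w)
    then obtain as where "set as \<subseteq> A" "w = refl_prod as" by blast
    with \<open>\<alpha> \<in> A\<close> show ?case by (intro exI[of _ "\<alpha> # as"]) simp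
  qed
  with that show thesis by blast
qed

section \<open>Positive roots and the fundamental chamber\<close>

locale simple_root_system =
  fixes \<Phi> \<Delta> :: "'a::euclidean_space set"
  assumes root_system: "root_system \<Phi>"
    and simple_system: "simple_system \<Phi> \<Delta>"
begin

text \<open>Coordinates in the basis \<open>\<Delta>\<close> are linear on its span, which suits
  computations with reflections; \<open>simple_system\<close> provides coefficients only by an
  existence statement for each root.\<close>

definition positive_roots :: "'a set" where
  "positive_roots = {\<gamma> \<in> \<Phi>. \<forall>\<alpha>\<in>\<Delta>. 0 \<le> representation \<Delta> \<gamma> \<alpha>}"

lemma finite_roots: "finite \<Phi>"
  and zero_not_root: "0 \<notin> \<Phi>"
  using root_system by (auto simp: root_system_def)

lemma uminus_root: "\<gamma> \<in> \<Phi> \<Longrightarrow> - \<gamma> \<in> \<Phi>"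
  using root_system by (auto simp: root_system_def)

lemma reflection_image_roots: "\<alpha> \<in> \<Phi> \<Longrightarrow> reflection \<alpha> ` \<Phi> = \<Phi>"
  using root_system by (auto simp: root_system_def)

lemma reflection_root: "\<alpha> \<in> \<Phi> \<Longrightarrow> \<gamma> \<in> \<Phi> \<Longrightarrow> reflection \<alpha> \<gamma> \<in> \<Phi>"
  using reflection_image_roots by blast

lemma root_multiple: "\<alpha> \<in> \<Phi> \<Longrightarrow> c *\<^sub>R \<alpha> \<in> \<Phi> \<Longrightarrow> c *\<^sub>R \<alpha> = \<alpha> \<or> c *\<^sub>R \<alpha> = - \<alpha>"
  using root_system span_scale[OF span_base[of \<alpha> "{\<alpha>}"], of c]
  unfolding root_system_def by blast

lemma simple_subset_roots: "\<Delta> \<subseteq> \<Phi>"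
  and independent_simple: "independent \<Delta>"
  using simple_system by (auto simp: simple_system_def)

lemma finite_simple: "finite \<Delta>"
  using simple_subset_roots finite_roots by (rule finite_subset)

lemma simple_rootE:
  assumes "\<gamma> \<in> \<Phi>"
  obtains c :: "'a \<Rightarrow> int"
  where "\<gamma> = (\<Sum>\<alpha>\<in>\<Delta>. of_int (c \<alpha>) *\<^sub>R \<alpha>)" "(\<forall>\<alpha>\<in>\<Delta>. 0 \<le> c \<alpha>) \<or> (\<forall>\<alpha>\<in>\<Delta>. c \<alpha> \<le> 0)"
  using simple_system assms unfolding simple_system_def by blast

lemma root_in_span_simple: "\<gamma> \<in> \<Phi> \<Longrightarrow> \<gamma> \<in> span \<Delta>"
  by (erule simple_rootE) (simp add: span_base span_scale span_sum)

lemma root_eq_sum: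
  "\<gamma> \<in> \<Phi> \<Longrightarrow> (\<Sum>\<alpha>\<in>\<Delta>. representation \<Delta> \<gamma> \<alpha> *\<^sub>R \<alpha>) = \<gamma>"
  by (intro real_vector.sum_representation_eq independent_simple root_in_span_simple
      finite_simple order_refl)

lemma inner_root_eq_sum:
  "\<gamma> \<in> \<Phi> \<Longrightarrow> x \<bullet> \<gamma> = (\<Sum>\<alpha>\<in>\<Delta>. representation \<Delta> \<gamma> \<alpha> * (x \<bullet> \<alpha>))"
  by (subst root_eq_sum[symmetric]) (simp_all add: inner_sum_right)

lemma representation_simple: "\<alpha> \<in> \<Delta> \<Longrightarrow> representation \<Delta> \<alpha> \<beta> = (if \<beta> = \<alpha> then 1 else 0)"
  using real_vector.representation_basis[OF independent_simple] by simp

text \<open>By independence of \<open>\<Delta>\<close> the coordinates of \<gamma> are the integers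
  supplied by \<open>simple_system\<close>, so they inherit the common sign.\<close>

lemma representation_root_signs:
  assumes "\<gamma> \<in> \<Phi>"
  shows "(\<forall>\<alpha>\<in>\<Delta>. 0 \<le> representation \<Delta> \<gamma> \<alpha>) \<or> (\<forall>\<alpha>\<in>\<Delta>. representation \<Delta> \<gamma> \<alpha> \<le> 0)"
proof -
  obtain c :: "'a \<Rightarrow> int" where c: "\<gamma> = (\<Sum>\<alpha>\<in>\<Delta>. of_int (c \<alpha>) *\<^sub>R \<alpha>)"
    and sgn: "(\<forall>\<alpha>\<in>\<Delta>. 0 \<le> c \<alpha>) \<or> (\<forall>\<alpha>\<in>\<Delta>. c \<alpha> \<le> 0)"
    using simple_rootE[OF assms] by blast
  have "representation \<Delta> \<gamma> \<alpha> = of_int (c \<alpha>)" if "\<alpha> \<in> \<Delta>" for \<alpha>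
  proof -
    have "representation \<Delta> \<gamma> \<alpha> = (\<Sum>\<beta>\<in>\<Delta>. representation \<Delta> (of_int (c \<beta>) *\<^sub>R \<beta>) \<alpha>)"
      unfolding c by (subst real_vector.representation_sum)
        (auto simp: independent_simple intro: span_scale span_base)
    also have "\<dots> = (\<Sum>\<beta>\<in>\<Delta>. of_int (c \<beta>) * (if \<beta> = \<alpha> then 1 else 0))"
      by (intro sum.cong refl)
        (auto simp: real_vector.representation_scale independent_simple span_base
          representation_simple)
    also have "\<dots> = of_int (c \<alpha>)"
      using that finite_simple by (simp add: if_distrib cong: if_cong)
    finally show ?thesis .
  qed
  with sgn show ?thesis by auto
qed

lemma representation_uminus_root:
  "\<gamma> \<in> \<Phi> \<Longrightarrow> representation \<Delta> (- \<gamma>) \<alpha> = - representation \<Delta> \<gamma> \<alpha>"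
  by (simp add: real_vector.representation_neg independent_simple root_in_span_simple)

lemma positive_root: "\<gamma> \<in> positive_roots \<Longrightarrow> \<gamma> \<in> \<Phi>"
  and simple_positive: "\<alpha> \<in> \<Delta> \<Longrightarrow> \<alpha> \<in> positive_roots"
  using simple_subset_roots by (auto simp: positive_roots_def representation_simple)

lemma positive_or_negative: "\<gamma> \<in> \<Phi> \<Longrightarrow> \<gamma> \<in> positive_roots \<or> - \<gamma> \<in> positive_roots"
  using representation_root_signs[of \<gamma>]
  by (auto simp: positive_roots_def uminus_root representation_uminus_root)

lemma uminus_not_positive:
  assumes "\<gamma> \<in> positive_roots"
  shows "- \<gamma> \<notin> positive_roots"
proof
  assume "- \<gamma> \<in> positive_roots"
  with assms have "representation \<Delta> \<gamma> \<alpha> = 0" if "\<alpha> \<in> \<Delta>" for \<alpha>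
    using that by (force simp: positive_roots_def representation_uminus_root)
  with root_eq_sum[OF positive_root[OF assms]] have "\<gamma> = 0" by simp
  with positive_root[OF assms] zero_not_root show False by simp
qed

section \<open>Simple reflections acting on positive roots\<close>

lemma representation_reflection:
  assumes "\<alpha> \<in> \<Delta>" "\<gamma> \<in> \<Phi>"
  shows "representation \<Delta> (reflection \<alpha> \<gamma>) \<beta> =
    representation \<Delta> \<gamma> \<beta> - (if \<beta> = \<alpha> then 2 * (\<gamma> \<bullet> \<alpha>) / (\<alpha> \<bullet> \<alpha>) else 0)"
  using assms unfolding reflection_def
  by (simp add: real_vector.representation_diff real_vector.representation_scale
      independent_simple root_in_span_simple span_base span_scale representation_simple)

text \<open>s_\<alpha> changes only the \<alpha>-coordinate. As \<Phi> is reduced, \<gamma> is not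
  supported on \<alpha> alone, so another strictly positive coordinate survives and decides the sign
  of the image.\<close>

lemma reflection_positive:
  assumes "\<alpha> \<in> \<Delta>" "\<gamma> \<in> positive_roots" "\<gamma> \<noteq> \<alpha>"
  shows "reflection \<alpha> \<gamma> \<in> positive_roots"
proof -
  have \<alpha>: "\<alpha> \<in> \<Phi>" and \<gamma>: "\<gamma> \<in> \<Phi>"
    using assms simple_subset_roots positive_root by auto
  have "\<exists>\<beta>\<in>\<Delta> - {\<alpha>}. representation \<Delta> \<gamma> \<beta> \<noteq> 0"
  proof (rule ccontr)
    assume "\<not> ?thesis"
    then have "\<gamma> = representation \<Delta> \<gamma> \<alpha> *\<^sub>R \<alpha>"
      using root_eq_sum[OF \<gamma>] finite_simple assms(1) by (simp add: sum.remove[of \<Delta> \<alpha>])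
    with root_multiple[OF \<alpha>] \<gamma> assms(3) have "\<gamma> = - \<alpha>" by metis
    with uminus_not_positive[OF simple_positive[OF assms(1)]] assms(2) show False by simp
  qed
  then obtain \<beta> where \<beta>: "\<beta> \<in> \<Delta>" "\<beta> \<noteq> \<alpha>" "representation \<Delta> \<gamma> \<beta> \<noteq> 0" by blast
  then have "0 < representation \<Delta> (reflection \<alpha> \<gamma>) \<beta>"
    using assms(2) by (simp add: representation_reflection[OF assms(1) \<gamma>] positive_roots_def
        order_less_le)
  with \<beta>(1) representation_root_signs[OF reflection_root[OF \<alpha> \<gamma>]]
  show ?thesis
    using reflection_root[OF \<alpha> \<gamma>] by (force simp: positive_roots_def)
qed

lemma refl_group_image_roots: "w \<in> refl_group \<Phi> \<Longrightarrow> w ` \<Phi> = \<Phi>"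
  by (induction rule: refl_group.induct) (simp_all only: image_comp[symmetric] image_id image_ident id_apply reflection_image_roots)

lemma refl_group_span: "w \<in> refl_group \<Phi> \<Longrightarrow> x \<in> span \<Phi> \<Longrightarrow> w x \<in> span \<Phi>"
  by (induction rule: refl_group.induct)
    (auto simp: reflection_def intro!: span_diff span_scale intro: span_base)

lemma inner_positive_root_nonneg:
  assumes "dominant \<Phi> \<Delta> x" "\<gamma> \<in> positive_roots"
  shows "0 \<le> x \<bullet> \<gamma>"
  using assms
  by (auto simp: inner_root_eq_sum[OF positive_root[OF assms(2)]] dominant_def
      fundamental_chamber_def positive_roots_def intro!: sum_nonneg)

text \<open>A positive root that is not simple has a positive inner product with some simple root, and
  reflecting there lowers its height; so a positive root of minimal height among those that are not
  conjugate to a simple root cannot exist.\<close>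
lemma reflection_root_in_simple_group:
  assumes "\<gamma> \<in> positive_roots"
  shows "reflection \<gamma> \<in> refl_group \<Delta>"
proof (rule ccontr)
  let ?h = "\<lambda>\<gamma>. \<Sum>\<alpha>\<in>\<Delta>. representation \<Delta> \<gamma> \<alpha>"
  let ?B = "{\<gamma> \<in> positive_roots. reflection \<gamma> \<notin> refl_group \<Delta>}"
  assume "reflection \<gamma> \<notin> refl_group \<Delta>"
  with assms have ne: "?B \<noteq> {}" by blast
  have fin: "finite ?B"
    by (rule finite_subset[OF _ finite_roots]) (auto dest: positive_root)
  define \<beta> where "\<beta> = arg_min_on ?h ?B"
  have \<beta>: "\<beta> \<in> positive_roots" "reflection \<beta> \<notin> refl_group \<Delta>"
    using arg_min_if_finite(1)[OF fin ne, of ?h] by (auto simp: \<beta>_def)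
  have minimal: "\<not> ?h \<delta> < ?h \<beta>" if "\<delta> \<in> ?B" for \<delta>
    using arg_min_if_finite(2)[OF fin ne, of ?h] that by (auto simp: \<beta>_def)
  have root: "\<beta> \<in> \<Phi>" using \<beta>(1) by (rule positive_root)
  then have "0 < \<beta> \<bullet> \<beta>" using zero_not_root by auto
  \<comment> \<open>Expanding one factor \<beta> in simple roots writes
    \<open>\<beta> \<bullet> \<beta>\<close> as the sum of these terms, and a positive sum has a
    positive term.\<close>
  then obtain \<alpha> where \<alpha>: "\<alpha> \<in> \<Delta>" "0 < representation \<Delta> \<beta> \<alpha> * (\<beta> \<bullet> \<alpha>)"
    unfolding inner_root_eq_sum[OF root]
    by (metis (no_types, lifting) not_less sum_nonpos)
  then have pos: "0 < \<beta> \<bullet> \<alpha>"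
    using \<beta>(1) by (auto simp: positive_roots_def zero_less_mult_iff)
  have "\<alpha> \<in> \<Phi>" using \<alpha> simple_subset_roots by blast
  then have "0 < \<alpha> \<bullet> \<alpha>" using zero_not_root by auto
  have "\<beta> \<noteq> \<alpha>" using \<beta>(2) \<alpha>(1) reflection_in_refl_group by blast
  let ?\<delta> = "reflection \<alpha> \<beta>"
  have "?\<delta> \<in> positive_roots" using \<alpha>(1) \<beta>(1) \<open>\<beta> \<noteq> \<alpha>\<close> by (rule reflection_positive)
  moreover have "?h ?\<delta> = ?h \<beta> - 2 * (\<beta> \<bullet> \<alpha>) / (\<alpha> \<bullet> \<alpha>)"
    using \<alpha>(1) finite_simple
    by (simp add: representation_reflection[OF \<alpha>(1) root] sum_subtractf)
  then have "?h ?\<delta> < ?h \<beta>" using pos \<open>0 < \<alpha> \<bullet> \<alpha>\<close> by simp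
  ultimately have "reflection ?\<delta> \<in> refl_group \<Delta>" using minimal by blast
  moreover have s: "reflection \<alpha> \<in> refl_group \<Delta>" using \<alpha>(1) by (rule reflection_in_refl_group)
  ultimately have "reflection \<alpha> \<circ> (reflection ?\<delta> \<circ> reflection \<alpha>) \<in> refl_group \<Delta>"
    by (intro refl_group_comp)
  moreover have "reflection \<alpha> \<circ> (reflection ?\<delta> \<circ> reflection \<alpha>) = reflection \<beta>"
    by (simp add: fun_eq_iff reflection_conjugate[OF s] reflection_involution)
  ultimately show False using \<beta>(2) by simp
qed

text \<open>Every root is positive or the negative of a positive root, and opposite roots have the
  same reflection. Words for Weyl group elements may therefore be taken in simple roots.\<close>

lemma refl_group_simple: "refl_group \<Phi> = refl_group \<Delta>"
proof
  have *: "reflection \<gamma> \<in> refl_group \<Delta>" if "\<gamma> \<in> \<Phi>" for \<gamma>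
    using positive_or_negative[OF that] reflection_root_in_simple_group reflection_uminus_root
    by metis
  have "w \<in> refl_group \<Delta>" if "w \<in> refl_group \<Phi>" for w
    using that
    by (induction rule: refl_group.induct) (blast intro: refl_group_id refl_group_comp *)+
  then show "refl_group \<Phi> \<subseteq> refl_group \<Delta>" by blast
qed (rule refl_group_mono[OF simple_subset_roots])

section \<open>The chamber as a fundamental domain\<close>

text \<open>Induction on the number of positive roots negative on \<open>x\<close>. Reflecting in a
  simple \<alpha> with \<open>x \<bullet> \<alpha> < 0\<close> permutes the other positive roots and
  makes the value at \<alpha> positive, so the count drops.\<close>

lemma exists_dominant_conjugate:
  assumes "x \<in> span \<Phi>"
  shows "\<exists>w\<in>refl_group \<Phi>. dominant \<Phi> \<Delta> (w x)"
  using assms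
proof (induction "card {\<gamma> \<in> positive_roots. x \<bullet> \<gamma> < 0}" arbitrary: x rule: less_induct)
  case less
  let ?N = "\<lambda>x. {\<gamma> \<in> positive_roots. x \<bullet> \<gamma> < 0}"
  have fin: "finite (?N y)" for y
    by (rule finite_subset[OF _ finite_roots]) (auto dest: positive_root)
  show ?case
  proof (cases "\<forall>\<alpha>\<in>\<Delta>. 0 \<le> x \<bullet> \<alpha>")
    case True
    then have "dominant \<Phi> \<Delta> (id x)"
      using less.prems by (simp add: dominant_def fundamental_chamber_def)
    then show ?thesis by (rule bexI[OF _ refl_group_id])
  next
    case False
    then obtain \<alpha> where \<alpha>: "\<alpha> \<in> \<Delta>" "x \<bullet> \<alpha> < 0" by (auto simp: not_le)
    have s: "reflection \<alpha> \<in> refl_group \<Phi>"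
      using \<alpha>(1) simple_subset_roots by (blast intro: reflection_in_refl_group)
    \<comment> \<open>The root \<alpha> is not in the source, since s_\<alpha> x is positive on it,
      and not in the image, since its preimage -\<alpha> is not positive.\<close>
    have "reflection \<alpha> ` ?N (reflection \<alpha> x) \<subseteq> ?N x - {\<alpha>}"
    proof (rule image_subsetI)
      fix \<gamma> assume "\<gamma> \<in> ?N (reflection \<alpha> x)"
      then have \<gamma>: "\<gamma> \<in> positive_roots" "x \<bullet> reflection \<alpha> \<gamma> < 0"
        by (auto simp: inner_reflection_left)
      with \<alpha>(2) have "\<gamma> \<noteq> \<alpha>" by (auto simp: reflection_self)
      with \<alpha>(1) \<gamma>(1) have "reflection \<alpha> \<gamma> \<in> positive_roots" by (blast intro: reflection_positive)
      moreover have "reflection \<alpha> \<gamma> \<noteq> \<alpha>"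
        using uminus_not_positive[OF simple_positive[OF \<alpha>(1)]] \<gamma>(1)
        by (metis reflection_involution reflection_self)
      ultimately show "reflection \<alpha> \<gamma> \<in> ?N x - {\<alpha>}" using \<gamma>(2) by simp
    qed
    then have "card (?N (reflection \<alpha> x)) \<le> card (?N x - {\<alpha>})"
      by (intro card_inj_on_le[of "reflection \<alpha>"] finite_Diff fin inj_on_inverseI)
        (rule reflection_involution)
    also have "\<dots> < card (?N x)"
      using \<alpha> simple_positive by (intro card_Diff1_less fin) simp
    finally obtain w where "w \<in> refl_group \<Phi>" "dominant \<Phi> \<Delta> (w (reflection \<alpha> x))"
      using less.hyps refl_group_span[OF s less.prems] by blast
    then show ?thesis
      using refl_group_comp[OF _ s] by (metis comp_apply)
  qed
qed

section \<open>Exchange property and stabilizers of dominant points\<close>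

text \<open>Follow \<alpha>, positive at first, through the letters from the right. A simple
  reflection makes only its own root negative, so where the sign changes the current root is the
  letter \<beta> itself. With v the product to the right of that letter, v \<alpha> = \<beta> gives
  s_\<beta> v s_\<alpha> = v, and the letter is deleted.\<close>

lemma refl_prod_exchange:
  assumes "set as \<subseteq> \<Delta>" "\<alpha> \<in> \<Delta>" "refl_prod as \<alpha> \<notin> positive_roots"
  shows "\<exists>bs. set bs \<subseteq> \<Delta> \<and> length bs < length as \<and> refl_prod as \<circ> reflection \<alpha> = refl_prod bs"
  using assms
proof (induction as)
  case Nil
  then show ?case using simple_positive by simp
next
  case (Cons \<beta> as)
  show ?case
  proof (cases "refl_prod as \<alpha> \<in> positive_roots")
    case True
    with Cons.prems have eq: "refl_prod as \<alpha> = \<beta>"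
      using reflection_positive[of \<beta> "refl_prod as \<alpha>"] by auto
    have "refl_prod as \<in> refl_group \<Delta>"
      using Cons.prems by (intro refl_prod_in_refl_group) simp
    then have "reflection \<beta> (refl_prod as (reflection \<alpha> x)) = refl_prod as x" for x
      using reflection_conjugate[of "refl_prod as" \<Delta> \<alpha> "reflection \<alpha> x"]
      by (simp add: eq reflection_involution)
    then have "refl_prod (\<beta> # as) \<circ> reflection \<alpha> = refl_prod as"
      by (simp add: fun_eq_iff)
    moreover have "set as \<subseteq> \<Delta>" "length as < length (\<beta> # as)" using Cons.prems by simp_all
    ultimately show ?thesis by blast
  next
    case False
    have "set as \<subseteq> \<Delta>" using Cons.prems(1) by simp
    from Cons.IH[OF this Cons.prems(2) False]
    obtain bs where "set bs \<subseteq> \<Delta>" "length bs < length as"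
      "refl_prod as \<circ> reflection \<alpha> = refl_prod bs" by blast
    with Cons.prems show ?thesis by (intro exI[of _ "\<beta> # bs"]) (simp add: fun_eq_iff)
  qed
qed

text \<open>Induction on the length of a word for \<open>w\<close> with last letter \<open>\<alpha>\<close>: if \<open>w \<alpha>\<close> is positive, the
  word can be shortened by the exchange property; if it is negative, dominance of \<open>x\<close> and \<open>w x\<close>
  forces \<open>x \<bullet> \<alpha> = 0\<close> and the last letter can be split off.\<close>
lemma refl_prod_dominant:
  assumes "set as \<subseteq> \<Delta>" "dominant \<Phi> \<Delta> x" "dominant \<Phi> \<Delta> (refl_prod as x)"
  shows "refl_prod as x = x \<and> refl_prod as \<in> refl_group (\<Delta> \<inter> {x}\<^sup>\<bottom>)"
  using assms
proof (induction as rule: length_induct)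
  case (1 as)
  show ?case
  proof (cases as rule: rev_cases)
    case Nil
    show ?thesis unfolding Nil refl_prod_simps(1) by (intro conjI id_apply refl_group_id)
  next
    case (snoc bs \<alpha>)
    let ?v = "refl_prod bs"
    have \<alpha>: "\<alpha> \<in> \<Delta>" and bs: "set bs \<subseteq> \<Delta>" using 1(2) snoc by auto
    have w: "refl_prod as = ?v \<circ> reflection \<alpha>" by (simp add: snoc refl_prod_append)
    show ?thesis
    proof (cases "?v \<alpha> \<in> positive_roots")
      case False
      then obtain cs where "set cs \<subseteq> \<Delta>" "length cs < length bs" "refl_prod as = refl_prod cs"
        using refl_prod_exchange[OF bs \<alpha>] w by metis
      with 1 snoc show ?thesis by simp
    next
      case True
      have "refl_prod as \<in> refl_group \<Delta>" using 1(2) by (rule refl_prod_in_refl_group)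
      moreover have "refl_prod as \<alpha> = - ?v \<alpha>"
        using linear_refl_group[OF refl_prod_in_refl_group[OF bs]]
        by (simp add: w reflection_self linear_neg)
      ultimately have "x \<bullet> \<alpha> = - (refl_prod as x \<bullet> ?v \<alpha>)"
        by (metis inner_refl_group inner_minus_right)
      then have "x \<bullet> \<alpha> \<le> 0" using inner_positive_root_nonneg[OF 1(4) True] by simp
      with inner_positive_root_nonneg[OF 1(3) simple_positive[OF \<alpha>]]
      have orth: "x \<bullet> \<alpha> = 0" by simp
      then have fixes_x: "refl_prod as x = ?v x"
        using reflection_eq_self_iff[of \<alpha> x] by (simp add: w)
      with 1 snoc bs have IH: "?v x = x \<and> ?v \<in> refl_group (\<Delta> \<inter> {x}\<^sup>\<bottom>)" by simp
      have "\<alpha> \<in> \<Delta> \<inter> {x}\<^sup>\<bottom>"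
        using \<alpha> orth by (simp add: orthogonal_comp_def orthogonal_def)
      with IH have "refl_prod as \<in> refl_group (\<Delta> \<inter> {x}\<^sup>\<bottom>)"
        unfolding w by (blast intro: refl_group_comp reflection_in_refl_group)
      with IH fixes_x show ?thesis by simp
    qed
  qed
qed

text \<open>A word in simple roots for \<open>w\<close> brings this down to
  \<open>refl_prod_dominant\<close>. The first conclusion makes the dominant point of an orbit
  unique; the second leads to Chevalley's theorem.\<close>

lemma dominant_conjugate:
  assumes "w \<in> refl_group \<Phi>" "dominant \<Phi> \<Delta> x" "dominant \<Phi> \<Delta> (w x)"
  shows "w x = x" "w \<in> refl_group (\<Delta> \<inter> {x}\<^sup>\<bottom>)"
proof -
  obtain as where "set as \<subseteq> \<Delta>" "w = refl_prod as"
    using assms(1) refl_group_refl_prodE unfolding refl_group_simple by blast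
  with refl_prod_dominant assms(2,3) show "w x = x" "w \<in> refl_group (\<Delta> \<inter> {x}\<^sup>\<bottom>)" by blast+
qed

text \<open>If \<open>w\<close> fixes \<open>x\<close>, then \<open>x\<close> and \<open>w x\<close>
  are both dominant and \<open>dominant_conjugate\<close> applies; conversely each generator on the
  right fixes \<open>x\<close>.\<close>

lemma stabilizer_dominant:
  assumes "dominant \<Phi> \<Delta> x"
  shows "{w \<in> refl_group \<Phi>. w x = x} = refl_group (\<Delta> \<inter> {x}\<^sup>\<bottom>)"
proof (intro equalityI subsetI CollectI conjI)
  fix w assume "w \<in> {w \<in> refl_group \<Phi>. w x = x}"
  with dominant_conjugate(2) assms show "w \<in> refl_group (\<Delta> \<inter> {x}\<^sup>\<bottom>)" by simp
next
  fix w assume w: "w \<in> refl_group (\<Delta> \<inter> {x}\<^sup>\<bottom>)"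
  then show "w \<in> refl_group \<Phi>"
    using refl_group_mono[of "\<Delta> \<inter> {x}\<^sup>\<bottom>" \<Phi>] simple_subset_roots by blast
  show "w x = x"
    using w by (rule refl_group_fixes) (auto simp: orthogonal_comp_def orthogonal_def)
qed

end

section \<open>Faces and their barycenters\<close>

text \<open>Extreme points are the singleton faces, and an injective linear map preserves and
  reflects faces.\<close>

lemma vertices_linear_image:
  assumes "linear f" "inj f"
  shows "vertices (f ` F) = f ` vertices F"
proof -
  have "f x extreme_point_of f ` F \<longleftrightarrow> x extreme_point_of F" for x
    using face_of_linear_image[OF assms, of "{x}" F] by (simp add: face_of_singleton)
  moreover have "y \<in> f ` F" if "y extreme_point_of f ` F" for y
    using that by (simp add: extreme_point_of_def)
  ultimately show ?thesis unfolding vertices_def by blast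
qed

lemma barycenter_linear_image:
  assumes "linear f" "inj f"
  shows "barycenter (f ` F) = f (barycenter F)"
proof -
  have inj: "inj_on f A" for A using assms(2) by (rule inj_on_subset) simp
  show ?thesis
    by (simp add: barycenter_def vertices_linear_image[OF assms] card_image[OF inj]
        sum.reindex[OF inj] linear_sum[OF assms(1)] linear_scale[OF assms(1)])
qed

text \<open>A polytope is the hull of its finitely many vertices, and a convex combination of all of
  them with strictly positive weights, here all equal, lies in the relative interior.\<close>

lemma barycenter_in_rel_interior:
  assumes "polytope F" "F \<noteq> {}"
  shows "barycenter F \<in> rel_interior F"
proof -
  let ?V = "vertices F"
  have F: "F = convex hull ?V"
    unfolding vertices_def using assms(1)
    by (intro Krein_Milman_Minkowski) (simp_all add: polytope_imp_compact polytope_imp_convex)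
  have fin: "finite ?V"
    unfolding vertices_def by (rule finite_polyhedron_extreme_points)
      (rule polytope_imp_polyhedron[OF assms(1)])
  have "?V \<noteq> {}" using F assms(2) by auto
  with fin have "0 < card ?V" by (simp add: card_gt_0_iff)
  then have "barycenter F \<in> rel_interior (convex hull ?V)"
    by (intro subsetD[OF explicit_subset_rel_interior_convex_hull_minimal[OF fin]] CollectI
        exI[of _ "\<lambda>_. 1 / real (card ?V)"])
      (simp add: barycenter_def scaleR_sum_right)
  with F show ?thesis by simp
qed

text \<open>This default value fits the convention that the empty face is standard, as 0 is
  dominant.\<close>

lemma barycenter_empty [simp]: "barycenter {} = 0"
  by (simp add: barycenter_def vertices_def extreme_point_of_def)

section \<open>The Weyl group acting on faces of the root polytope\<close>

context simple_root_system
begin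

text \<open>\<open>w\<close> permutes the roots, so it maps their hull onto itself, and injective
  linear maps carry faces to faces.\<close>

lemma face_image:
  assumes "F face_of root_polytope \<Phi>" "w \<in> refl_group \<Phi>"
  shows "w ` F face_of root_polytope \<Phi>"
proof -
  have w: "linear w" "inj w"
    using assms(2) by (auto intro: linear_refl_group bij_is_inj bij_refl_group)
  then have "w ` root_polytope \<Phi> = root_polytope \<Phi>"
    using refl_group_image_roots[OF assms(2)]
    by (simp add: root_polytope_def convex_hull_linear_image)
  with assms(1) face_of_linear_image[OF w] show ?thesis by metis
qed

lemma barycenter_image:
  "w \<in> refl_group \<Phi> \<Longrightarrow> barycenter (w ` F) = w (barycenter F)"
  by (intro barycenter_linear_image linear_refl_group bij_is_inj bij_refl_group)

lemma face_barycenter_in_rel_interior: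
  assumes "F face_of root_polytope \<Phi>" "F \<noteq> {}"
  shows "barycenter F \<in> rel_interior F"
  using assms finite_roots unfolding root_polytope_def
  by (intro barycenter_in_rel_interior) (auto intro: face_of_polytope_polytope polytope_convex_hull)

text \<open>Dominance includes membership in \<open>span \<Phi>\<close>, which is not automatic
  because the roots may fail to span the ambient space.\<close>

lemma barycenter_in_span:
  assumes "F face_of root_polytope \<Phi>"
  shows "barycenter F \<in> span \<Phi>"
proof (cases "F = {}")
  case False
  have "barycenter F \<in> root_polytope \<Phi>"
    using face_barycenter_in_rel_interior[OF assms False] rel_interior_subset
      face_of_imp_subset[OF assms] by blast
  then show ?thesis
    unfolding root_polytope_def using convex_hull_subset_span by blast
qed (simp add: span_zero)

text \<open>This replaces faces by points. A barycenter fixed by \<open>w\<close> lies in the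
  relative interiors of both \<open>F\<close> and its image, and two faces whose relative interiors
  meet are equal.\<close>

lemma face_image_eq_iff:
  assumes F: "F face_of root_polytope \<Phi>" and w: "w \<in> refl_group \<Phi>"
  shows "w ` F = F \<longleftrightarrow> w (barycenter F) = barycenter F"
proof
  assume "w ` F = F"
  with barycenter_image[OF w, of F] show "w (barycenter F) = barycenter F" by simp
next
  assume fixed: "w (barycenter F) = barycenter F"
  show "w ` F = F"
  proof (cases "F = {}")
    case False
    have "barycenter F \<in> rel_interior (w ` F)"
      using face_barycenter_in_rel_interior[OF face_image[OF F w]] barycenter_image[OF w, of F]
        fixed False by simp
    with face_barycenter_in_rel_interior[OF F False] show ?thesis
      by (intro face_of_eq[OF face_image[OF F w] F]) blast
  qed simp
qed

text \<open>Applied to simple \<alpha>, this carries dominance from any relative interior point to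
  the barycenter. A negative sign there would force the hyperplane of \<alpha> to meet the relative
  interior, so that s_\<alpha> would stabilize \<open>F\<close> and fix its barycenter.\<close>

lemma inner_barycenter_nonneg:
  assumes F: "F face_of root_polytope \<Phi>" and "\<alpha> \<in> \<Phi>"
    and x: "x \<in> rel_interior F" "0 \<le> x \<bullet> \<alpha>"
  shows "0 \<le> barycenter F \<bullet> \<alpha>"
proof (rule ccontr)
  let ?b = "barycenter F" and ?s = "reflection \<alpha>"
  assume neg: "\<not> 0 \<le> ?b \<bullet> \<alpha>"
  have s: "?s \<in> refl_group \<Phi>" using \<open>\<alpha> \<in> \<Phi>\<close> by (rule reflection_in_refl_group)
  have convex: "convex F" using F by (rule face_of_imp_convex)
  have "F \<noteq> {}" using x rel_interior_subset by blast
  then have b: "?b \<in> rel_interior F" by (rule face_barycenter_in_rel_interior[OF F])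
  have "connected (rel_interior F)"
    by (intro convex_connected convex_rel_interior convex)
  \<comment> \<open>Intermediate value on the connected relative interior, between the barycenter on
    the negative side and \<open>x\<close> on the nonnegative side.\<close>
  then obtain y where y: "y \<in> rel_interior F" "y \<bullet> \<alpha> = 0"
    using connected_ivt_hyperplane[of "rel_interior F" ?b x \<alpha> 0] b x neg
    by (auto simp: inner_commute)
  have "rel_interior (?s ` F) = ?s ` rel_interior F"
    by (intro rel_interior_injective_linear_image linear_conv_bounded_linear[THEN iffD1]
        linear_reflection bij_is_inj bij_refl_group[OF s])
  \<comment> \<open>s_\<alpha> fixes y, so y is a relative interior point of the mirror image as
    well.\<close>
  then have "y \<in> rel_interior (?s ` F)"
    using y reflection_eq_self_iff[of \<alpha> y] by (metis imageI)
  with y(1) have "?s ` F = F"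
    by (intro face_of_eq[OF face_image[OF F s] F]) blast
  then have "?s ?b = ?b" using face_image_eq_iff[OF F s] by simp
  with neg show False by (simp add: reflection_eq_self_iff)
qed

section \<open>Standard faces, their stabilizers and orbits\<close>

lemma standard_face_iff_dominant:
  assumes F: "F face_of root_polytope \<Phi>"
  shows "standard_face \<Phi> \<Delta> F \<longleftrightarrow> dominant \<Phi> \<Delta> (barycenter F)"
proof (cases "F = {}")
  case True
  then show ?thesis
    by (simp add: standard_face_def dominant_def fundamental_chamber_def span_zero)
next
  case False
  show ?thesis
  proof
    assume "standard_face \<Phi> \<Delta> F"
    with False obtain x where x: "x \<in> rel_interior F" "\<forall>\<alpha>\<in>\<Delta>. 0 \<le> x \<bullet> \<alpha>"
      by (auto simp: standard_face_def fundamental_chamber_def)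
    with inner_barycenter_nonneg[OF F _ x(1)] simple_subset_roots barycenter_in_span[OF F]
    show "dominant \<Phi> \<Delta> (barycenter F)"
      by (auto simp: dominant_def fundamental_chamber_def)
  next
    assume "dominant \<Phi> \<Delta> (barycenter F)"
    with face_barycenter_in_rel_interior[OF F False] show "standard_face \<Phi> \<Delta> F"
      by (auto simp: standard_face_def dominant_def)
  qed
qed

text \<open>\<open>F\<close> and its barycenter have the same stabilizer, and for a dominant point
  this is Chevalley's theorem.\<close>

lemma face_stabilizer_standard:
  assumes F: "F face_of root_polytope \<Phi>" and "standard_face \<Phi> \<Delta> F"
  shows "face_stabilizer (Weyl_group \<Phi>) F = refl_group (\<Delta> \<inter> {barycenter F}\<^sup>\<bottom>)"
  using stabilizer_dominant[of "barycenter F"] assms face_image_eq_iff[OF F]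
  by (auto simp: face_stabilizer_def Weyl_group_def standard_face_iff_dominant)

text \<open>The two barycenters are dominant and conjugate under \<open>w\<close>, hence equal, and
  a fixed barycenter means a fixed face.\<close>

lemma standard_conjugate_unique:
  assumes F: "F face_of root_polytope \<Phi>" and w: "w \<in> refl_group \<Phi>"
    and "standard_face \<Phi> \<Delta> F" "standard_face \<Phi> \<Delta> (w ` F)"
  shows "w ` F = F"
proof -
  have "dominant \<Phi> \<Delta> (barycenter F)" "dominant \<Phi> \<Delta> (w (barycenter F))"
    using assms standard_face_iff_dominant[OF F] standard_face_iff_dominant[OF face_image[OF F w]]
      barycenter_image[OF w, of F] by simp_all
  then have "w (barycenter F) = barycenter F" by (rule dominant_conjugate(1)[OF w])
  then show ?thesis using face_image_eq_iff[OF F w] by simp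
qed

text \<open>A group element moving the barycenter into the chamber moves \<open>F\<close> to a
  standard face; uniqueness comes from \<open>standard_conjugate_unique\<close>.\<close>

lemma ex1_standard_face_in_orbit:
  assumes F: "F face_of root_polytope \<Phi>"
  shows "\<exists>!G. G \<in> face_orbit (Weyl_group \<Phi>) F \<and> standard_face \<Phi> \<Delta> G"
proof -
  obtain w where w: "w \<in> refl_group \<Phi>" "dominant \<Phi> \<Delta> (w (barycenter F))"
    using exists_dominant_conjugate[OF barycenter_in_span[OF F]] by blast
  let ?G = "w ` F"
  have G: "?G face_of root_polytope \<Phi>" by (rule face_image[OF F w(1)])
  have std: "standard_face \<Phi> \<Delta> ?G"
    using w barycenter_image[OF w(1), of F] standard_face_iff_dominant[OF G] by simp
  obtain v where v: "v \<in> refl_group \<Phi>" "v \<circ> w = id"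
    using refl_group_inverse[OF w(1)] by blast
  show ?thesis
  proof (rule ex1I[of _ ?G])
    show "?G \<in> face_orbit (Weyl_group \<Phi>) F \<and> standard_face \<Phi> \<Delta> ?G"
      using w(1) std by (auto simp: face_orbit_def Weyl_group_def)
  next
    fix H assume "H \<in> face_orbit (Weyl_group \<Phi>) F \<and> standard_face \<Phi> \<Delta> H"
    then obtain u where u: "u \<in> refl_group \<Phi>" "H = u ` F" and H: "standard_face \<Phi> \<Delta> H"
      by (auto simp: face_orbit_def Weyl_group_def)
    \<comment> \<open>As \<open>v\<close> inverts \<open>w\<close>, the competitor \<open>H\<close>
      is an image of \<open>?G\<close> itself, so two standard faces conjugate to each other are
      being compared.\<close>
    have "(u \<circ> v) ` ?G = u ` (v \<circ> w) ` F" by (simp add: image_comp comp_assoc)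
    then have "(u \<circ> v) ` ?G = H" using v(2) u(2) by simp
    with standard_conjugate_unique[OF G refl_group_comp[OF u(1) v(1)] std] H
    show "H = ?G" by simp
  qed
qed

end

theorem theorem3p6:
  fixes \<Phi> \<Delta> F :: "'a::euclidean_space set"
  assumes "root_system \<Phi>"
    and "simple_system \<Phi> \<Delta>"
    and "F face_of root_polytope \<Phi>"
  shows "(standard_face \<Phi> \<Delta> F \<longleftrightarrow> dominant \<Phi> \<Delta> (barycenter F)) \<and>
    (standard_face \<Phi> \<Delta> F \<longrightarrow>
       face_stabilizer (Weyl_group \<Phi>) F = refl_group (\<Delta> \<inter> {barycenter F}\<^sup>\<bottom>)) \<and>
    (\<exists>!G. G \<in> face_orbit (Weyl_group \<Phi>) F \<and> standard_face \<Phi> \<Delta> G)"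
proof -
  interpret simple_root_system \<Phi> \<Delta>
    by unfold_locales (fact assms)+
  show ?thesis
    using standard_face_iff_dominant face_stabilizer_standard ex1_standard_face_in_orbit assms(3)
    by simp
qed

end
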